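(* Let $n\ge 2$ be an integer and let $\mathcal{H}\neq\{0\}$ be a real Hilbert space. For any sequence $v_1,v_2,\dots,v_n$ of vectors in $\mathcal{H}$, there exists a unit vector $v$ in $\mathcal{H}$ such that $$\left\Vert\sum_{k=1}^n x_k v_k\right\Vert_{\mathcal{H}}^2\ \leq\ n(n-1)\sum_{k=1}^n x_k^2\,|\langle v,v_k\rangle|^2$$ for all $x=(x_1,\dots,x_n)\in\mathbb{R}^n$.
   Context: $\langle\cdot,\cdot\rangle$ and $\Vert\cdot\Vert_{\mathcal{H}}$ denote the inner product and norm of $\mathcal{H}$; a unit vector is a vector of norm $1$. *)

theory Defs
  imports "HOL-Analysis.Analysis"
begin

end

theory Submission
  imports Defs
begin

text \<open>
  Zero vectors are harmless, so let all \<open>w k\<close> be nonzero, and let \<open>v\<close> maximize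
  \<open>\<bar>\<Prod>k. v \<bullet> w k\<bar>\<close> over the unit sphere of the span. For a unit vector \<open>u \<bottom> v\<close> in the span
  put \<open>y k = (u \<bullet> w k) / (v \<bullet> w k)\<close>. Maximality along the great circle through \<open>v\<close> and \<open>u\<close>
  says that \<open>T t = (\<Prod>k. cos t + y k * sin t)\<close> satisfies \<open>\<bar>T\<bar> \<le> 1 = T 0\<close>. Hence \<open>T' 0 = 0\<close>,
  which is \<open>\<Sum>y = 0\<close>, and Bernstein's inequality \<open>\<bar>T'' 0\<bar> \<le> n\<^sup>2\<close> gives \<open>\<Sum>y\<^sup>2 \<le> n * (n - 1)\<close>.
  So the vectors \<open>w k / (v \<bullet> w k)\<close> form a Bessel system with bound \<open>n * (n - 1)\<close>,
  and the claim follows by the Cauchy-Schwarz inequality.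
\<close>

section \<open>Bernstein's inequality at \<open>0\<close> by Riesz interpolation\<close>

text \<open>
  A Riesz-type interpolation formula: on trigonometric polynomials with frequencies
  \<open>n - 2 * l\<close>, \<open>l \<le> n\<close>, minus the second derivative at \<open>0\<close> is a combination of the values at
  the points \<open>pi * j / n\<close> with coefficients \<open>(-1) ^ j * b j\<close>; the case \<open>l = 0\<close> shows
  that the \<open>b j\<close> add up to \<open>n\<^sup>2\<close>.
\<close>
lemma riesz_interpolation_weights:
  fixes n :: nat
  assumes "n \<ge> 1"
  shows "\<exists>b :: nat \<Rightarrow> real. (\<forall>j<n. b j \<ge> 0) \<and> (\<forall>l\<le>n.
    (\<Sum>j<n. of_real (b j) * cis (2 * pi * real j / real n) ^ l) = of_real ((2 * real l - real n)\<^sup>2))"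
proof -
  define z where "z j = cis (2 * pi * real j / real n)" for j
  \<comment> \<open>On the unit circle \<open>(z - 1)^2 = - 2 * (1 - Re z) * z\<close>, so these
    weights turn the second difference in \<open>l\<close> of \<open>c j * z j ^ l\<close> into
    \<open>- 8 * z j ^ Suc l\<close>. Summed over the \<open>n\<close>-th roots of unity other than
    \<open>1\<close> this gives \<open>8\<close>, the second difference of
    \<open>(2 * l - n)^2\<close>. The weight \<open>b 0\<close>, which second differences do not
    see, is set so that the case \<open>l = 0\<close> holds.\<close>
  define c where "c j = 4 / (1 - Re (z j))" for j
  define b where "b j = (if j = 0 then (real n)\<^sup>2 - (\<Sum>i\<in>{1..<n}. c i) else c j)" for j
  define g where "g l = (\<Sum>j<n. of_real (b j) * z j ^ l)" for l
  have z0: "z 0 = 1" by (simp add: z_def)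
  \<comment> \<open>This symmetry turns a sum over the roots with a fixed exponent into a geometric
    series with ratio \<open>z l\<close>.\<close>
  have zpow: "z j ^ l = z l ^ j" for j l
    unfolding z_def Complex.DeMoivre by (intro arg_cong[of _ _ cis]) (simp add: mult_ac)
  have zn: "z j ^ n = 1" for j
  proof -
    have "z j ^ n = cis (2 * pi * real j)"
      using assms by (simp add: z_def Complex.DeMoivre)
    then show ?thesis by (simp add: cis_multiple_2pi)
  qed
  have zne: "z j \<noteq> 1" if "0 < j" "j < n" for j
  proof
    assume "z j = 1"
    then have "z j = z 0" by (simp add: z0)
    moreover have "inj_on z {..<n}"
      using Complex.bij_betw_roots_unity[of n] assms unfolding z_def bij_betw_def by simp
    ultimately show False using that by (auto dest: inj_onD)
  qed
  have geo: "(\<Sum>j<n. z l ^ j) = 0" if "0 < l" "l < n" for l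
    using zne[OF that] zn[of l] by (simp add: geometric_sum)
  have re: "Re (z j) < 1" if "0 < j" "j < n" for j
  proof -
    have "Re (z j) \<le> 1" using complex_Re_le_cmod[of "z j"] by (simp add: z_def)
    moreover have "Re (z j) \<noteq> 1"
    proof
      assume *: "Re (z j) = 1"
      have "(cmod (z j))\<^sup>2 = 1" by (simp add: z_def)
      with * have "Im (z j) = 0" by (simp add: cmod_power2)
      with * have "z j = 1" by (simp add: complex_eq_iff)
      with zne[OF that] show False by simp
    qed
    ultimately show ?thesis by simp
  qed
  have quad: "of_real (c j) * ((z j)\<^sup>2 + 1 - 2 * z j) = - 8 * z j" if "0 < j" "j < n" for j
  proof -
    have "z j * cnj (z j) = 1" by (simp add: z_def cis_cnj cis_mult)
    then have "(z j)\<^sup>2 + 1 = z j * (z j + cnj (z j))" by (simp add: power2_eq_square algebra_simps)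
    also have "\<dots> = 2 * of_real (Re (z j)) * z j" by (simp add: complex_add_cnj)
    finally have e: "(z j)\<^sup>2 + 1 - 2 * z j = of_real (- 2 * (1 - Re (z j))) * z j"
      by (simp add: algebra_simps)
    have "c j * (- 2 * (1 - Re (z j))) = - 8" using re[OF that] by (simp add: c_def field_simps)
    then have "of_real (c j) * of_real (- 2 * (1 - Re (z j))) = (- 8 :: complex)"
      by (metis of_real_mult of_real_minus of_real_numeral)
    then show ?thesis unfolding e by (simp only: mult.assoc[symmetric])
  qed
  have split: "{..<n} = insert 0 {1..<n}" using assms by auto
  have g0: "g 0 = of_real ((real n)\<^sup>2)"
    unfolding g_def split by (simp add: b_def flip: of_real_sum)
  have gn: "g n = g 0" by (simp add: g_def zn)
  have diff: "g (Suc (Suc l)) + g l - 2 * g (Suc l) = 8" if "Suc l < n" for l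
  proof -
    have "g (Suc (Suc l)) + g l - 2 * g (Suc l)
        = (\<Sum>j<n. of_real (b j) * ((z j)\<^sup>2 + 1 - 2 * z j) * z j ^ l)"
      by (simp add: g_def sum_distrib_left power2_eq_square algebra_simps
          flip: sum.distrib sum_subtractf)
    also have "\<dots> = (\<Sum>j\<in>{1..<n}. - 8 * z j ^ Suc l)"
      unfolding split by (simp add: z0, intro sum.cong) (auto simp: b_def quad)
    also have "\<dots> = - 8 * ((\<Sum>j<n. z j ^ Suc l) - 1)"
      unfolding split by (simp add: z0 sum_distrib_left)
    also have "(\<Sum>j<n. z j ^ Suc l) = 0"
      using geo[of "Suc l"] that by (simp only: zpow[of _ "Suc l"])
    finally show ?thesis by simp
  qed
  \<comment> \<open>Both sides agree at \<open>0\<close> and \<open>n\<close> and have the same second differences in between.\<close>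
  define h where "h l = g l - of_real ((2 * real l - real n)\<^sup>2)" for l
  have h0: "h 0 = 0" by (simp add: h_def g0)
  have hn: "h n = 0" by (simp add: h_def gn g0)
  have hd: "h (Suc (Suc l)) = 2 * h (Suc l) - h l" if "Suc l < n" for l
    using diff[OF that] by (simp add: h_def power2_eq_square algebra_simps)
  \<comment> \<open>Vanishing second differences make \<open>h\<close> linear; two consecutive
    values are carried because the recursion has order two. Then \<open>h n = 0\<close> forces the
    slope \<open>h 1\<close> to vanish.\<close>
  have lin: "h l = of_nat l * h 1 \<and> (Suc l \<le> n \<longrightarrow> h (Suc l) = of_nat (Suc l) * h 1)" if "l \<le> n" for l
    using that
  proof (induction l)
    case 0
    then show ?case by (simp add: h0)
  next
    case (Suc l)
    then show ?case using hd[of l] by (auto simp: algebra_simps)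
  qed
  have "h 1 = 0" using lin[of n] hn assms by simp
  then have g: "g l = of_real ((2 * real l - real n)\<^sup>2)" if "l \<le> n" for l
    using lin[OF that] by (simp add: h_def)
  \<comment> \<open>The constant coefficient \<open>b 0\<close> is the mean of the squares on the right.\<close>
  have "of_real (\<Sum>l<n. (2 * real l - real n)\<^sup>2) = (\<Sum>l<n. g l)"
    by (simp add: g)
  also have "\<dots> = (\<Sum>j<n. of_real (b j) * (\<Sum>l<n. z j ^ l))"
    unfolding g_def by (subst sum.swap) (simp add: sum_distrib_left)
  also have "\<dots> = (\<Sum>j<n. if j = 0 then of_real (b 0 * real n) else 0)"
    by (intro sum.cong refl) (simp add: geo z0)
  also have "\<dots> = of_real (b 0 * real n)" using assms by simp
  finally have "(\<Sum>l<n. (2 * real l - real n)\<^sup>2) = b 0 * real n"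
    by (simp only: of_real_eq_iff)
  then have "0 \<le> b 0 * real n" by (metis sum_nonneg zero_le_power2)
  then have b0: "b 0 \<ge> 0" using assms by (simp add: zero_le_mult_iff)
  show ?thesis
  proof (intro exI[of _ b] conjI allI impI)
    show "b j \<ge> 0" if "j < n" for j
      using b0 re[of j] that by (cases "j = 0") (auto simp: b_def c_def)
    show "(\<Sum>j<n. of_real (b j) * cis (2 * pi * real j / real n) ^ l) = of_real ((2 * real l - real n)\<^sup>2)"
      if "l \<le> n" for l
      using g[OF that] by (simp add: g_def z_def)
  qed
qed

text \<open>
  With \<open>z = cis (2 * t)\<close> the left-hand product is \<open>cis (n * t) * (\<Prod>k. cos t + y k * sin t)\<close>,
  so the last two sums encode the first two derivatives of \<open>\<Prod>k. cos t + y k * sin t\<close> at \<open>t = 0\<close>.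
\<close>
lemma prod_linear_moments:
  fixes y :: "'a \<Rightarrow> real"
  assumes "finite I"
  shows "\<exists>q :: nat \<Rightarrow> complex.
    (\<forall>z. (\<Prod>k\<in>I. (1 + \<i> * y k) / 2 + (1 - \<i> * y k) / 2 * z) = (\<Sum>l\<le>card I. q l * z ^ l)) \<and>
    (\<Sum>l\<le>card I. q l) = 1 \<and>
    (\<Sum>l\<le>card I. (2 * of_nat l - of_nat (card I)) * q l) = - \<i> * (\<Sum>k\<in>I. y k) \<and>
    (\<Sum>l\<le>card I. (2 * of_nat l - of_nat (card I))\<^sup>2 * q l)
      = of_real (card I + (\<Sum>k\<in>I. (y k)\<^sup>2) - (\<Sum>k\<in>I. y k)\<^sup>2)"
  using assms
proof induction
  case empty
  show ?case by (rule exI[of _ "\<lambda>_. 1"]) simp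
next
  case (insert i I)
  define N where "N = card I"
  from insert.IH obtain q where
    q: "\<And>z. (\<Prod>k\<in>I. (1 + \<i> * y k) / 2 + (1 - \<i> * y k) / 2 * z) = (\<Sum>l\<le>N. q l * z ^ l)"
    and q0: "(\<Sum>l\<le>N. q l) = 1"
    and q1: "(\<Sum>l\<le>N. (2 * of_nat l - of_nat N) * q l) = - \<i> * (\<Sum>k\<in>I. y k)"
    and q2: "(\<Sum>l\<le>N. (2 * of_nat l - of_nat N)\<^sup>2 * q l)
      = of_real (N + (\<Sum>k\<in>I. (y k)\<^sup>2) - (\<Sum>k\<in>I. y k)\<^sup>2)"
    unfolding N_def by blast
  define a where "a = (1 - \<i> * y i) / 2"
  define b where "b = (1 + \<i> * y i) / 2"
  have ab: "a + b = 1" "a - b = - \<i> * y i" by (simp_all add: a_def b_def field_simps)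
  \<comment> \<open>Coefficients of \<open>(b + a * z)\<close> times the old polynomial; the first
    guard is there because nothing is known about \<open>q\<close> beyond \<open>N\<close>.\<close>
  define p where "p l = (if l \<le> N then b * q l else 0) + (if l = 0 then 0 else a * q (l - 1))" for l
  have shift: "(\<Sum>l\<le>Suc N. F l * p l) = (\<Sum>l\<le>N. (b * F l + a * F (Suc l)) * q l)" for F
  proof -
    have "(\<Sum>l\<le>Suc N. F l * p l) = (\<Sum>l\<le>Suc N. F l * (if l \<le> N then b * q l else 0))
        + (\<Sum>l\<le>Suc N. F l * (if l = 0 then 0 else a * q (l - 1)))"
      by (simp only: p_def distrib_left sum.distrib)
    also have "(\<Sum>l\<le>Suc N. F l * (if l \<le> N then b * q l else 0)) = (\<Sum>l\<le>N. F l * (b * q l))"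
      by simp
    also have "(\<Sum>l\<le>Suc N. F l * (if l = 0 then 0 else a * q (l - 1))) = (\<Sum>l\<le>N. F (Suc l) * (a * q l))"
      by (simp only: sum.atMost_Suc_shift) simp
    finally show ?thesis by (simp add: algebra_simps flip: sum.distrib)
  qed
  have card: "card (insert i I) = Suc N" using insert by (simp add: N_def)
  show ?case unfolding card
  proof (intro exI[of _ p] conjI allI)
    fix z
    have "(\<Prod>k\<in>insert i I. (1 + \<i> * y k) / 2 + (1 - \<i> * y k) / 2 * z)
        = (b + a * z) * (\<Sum>l\<le>N. q l * z ^ l)"
      unfolding q[symmetric] a_def b_def by (simp only: prod.insert[OF insert.hyps])
    also have "\<dots> = (\<Sum>l\<le>Suc N. z ^ l * p l)"
      unfolding shift by (simp add: sum_distrib_left algebra_simps)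
    finally show "(\<Prod>k\<in>insert i I. (1 + \<i> * y k) / 2 + (1 - \<i> * y k) / 2 * z) = (\<Sum>l\<le>Suc N. p l * z ^ l)"
      by (simp only: mult.commute)
  next
    show "sum p {..Suc N} = 1"
      using shift[of "\<lambda>_. 1"] ab q0 by (simp add: add.commute)
  next
    \<comment> \<open>Passing from \<open>N\<close> to \<open>Suc N\<close>, the term with
      \<open>b\<close> lowers the centred frequency \<open>2 * l - N\<close> by \<open>1\<close> and
      the term with \<open>a\<close> raises it by \<open>1\<close>. So only \<open>a + b\<close> and
      \<open>a - b\<close> enter the new moments.\<close>
    have "(\<Sum>l\<le>Suc N. (2 * of_nat l - of_nat (Suc N)) * p l)
        = (\<Sum>l\<le>N. ((2 * of_nat l - of_nat N) * (a + b) + (a - b)) * q l)"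
      unfolding shift by (intro sum.cong refl) (simp add: algebra_simps)
    also have "\<dots> = (\<Sum>l\<le>N. (2 * of_nat l - of_nat N) * q l) - \<i> * y i * (\<Sum>l\<le>N. q l)"
      by (simp add: ab sum_distrib_left algebra_simps sum.distrib sum_subtractf)
    also have "\<dots> = - \<i> * (\<Sum>k\<in>insert i I. y k)"
      using insert.hyps unfolding q0 q1 by (simp add: algebra_simps)
    finally show "(\<Sum>l\<le>Suc N. (2 * of_nat l - of_nat (Suc N)) * p l) = - \<i> * (\<Sum>k\<in>insert i I. y k)" .
  next
    have "(\<Sum>l\<le>Suc N. (2 * of_nat l - of_nat (Suc N))\<^sup>2 * p l)
        = (\<Sum>l\<le>N. (((2 * of_nat l - of_nat N)\<^sup>2 + 1) * (a + b) + 2 * (2 * of_nat l - of_nat N) * (a - b)) * q l)"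
      unfolding shift by (intro sum.cong refl) (simp add: algebra_simps power2_eq_square)
    also have "\<dots> = (\<Sum>l\<le>N. (2 * of_nat l - of_nat N)\<^sup>2 * q l) + (\<Sum>l\<le>N. q l)
        + 2 * (- \<i> * y i) * (\<Sum>l\<le>N. (2 * of_nat l - of_nat N) * q l)"
      unfolding ab sum_distrib_left sum.distrib[symmetric]
      by (intro sum.cong refl) (simp add: algebra_simps)
    also have "\<dots> = of_real (N + (\<Sum>k\<in>I. (y k)\<^sup>2) - (\<Sum>k\<in>I. y k)\<^sup>2 + 1 - 2 * y i * (\<Sum>k\<in>I. y k))"
      unfolding q0 q1 q2 by (simp add: algebra_simps)
    also have "\<dots> = of_real (Suc N + (\<Sum>k\<in>insert i I. (y k)\<^sup>2) - (\<Sum>k\<in>insert i I. y k)\<^sup>2)"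
      using insert by (intro arg_cong[of _ _ of_real]) (simp add: power2_eq_square algebra_simps)
    finally show "(\<Sum>l\<le>Suc N. (2 * of_nat l - of_nat (Suc N))\<^sup>2 * p l)
      = of_real (Suc N + (\<Sum>k\<in>insert i I. (y k)\<^sup>2) - (\<Sum>k\<in>insert i I. y k)\<^sup>2)" .
  qed
qed

text \<open>The left-hand side is minus the second derivative at \<open>0\<close> of the product.
  Interpolation writes it as a combination of values of \<open>Q\<close> at the \<open>n\<close>-th
  roots of unity. These have modulus at most \<open>1\<close>, and the weights are nonnegative with
  sum \<open>n^2\<close>.\<close>

lemma sum_squares_le_of_prod_bounded:
  fixes y :: "'a \<Rightarrow> real"
  assumes fin: "finite I" and ne: "I \<noteq> {}"
    and bound: "\<And>t. \<bar>\<Prod>k\<in>I. cos t + y k * sin t\<bar> \<le> 1"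
  shows "card I + (\<Sum>k\<in>I. (y k)\<^sup>2) - (\<Sum>k\<in>I. y k)\<^sup>2 \<le> (real (card I))\<^sup>2"
proof -
  define n where "n = card I"
  have n: "n \<ge> 1" using fin ne by (simp add: n_def Suc_le_eq card_gt_0_iff)
  obtain b where b: "\<And>j. j < n \<Longrightarrow> b j \<ge> 0"
    and bs: "\<And>l. l \<le> n \<Longrightarrow>
      (\<Sum>j<n. of_real (b j) * cis (2 * pi * real j / real n) ^ l) = of_real ((2 * real l - real n)\<^sup>2)"
    using riesz_interpolation_weights[OF n] by blast
  define Q where "Q z = (\<Prod>k\<in>I. (1 + \<i> * y k) / 2 + (1 - \<i> * y k) / 2 * z)" for z
  obtain q where q: "\<And>z. Q z = (\<Sum>l\<le>n. q l * z ^ l)"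
    and q2: "(\<Sum>l\<le>n. (2 * of_nat l - of_nat n)\<^sup>2 * q l)
      = of_real (n + (\<Sum>k\<in>I. (y k)\<^sup>2) - (\<Sum>k\<in>I. y k)\<^sup>2)"
    using prod_linear_moments[OF fin, of y] unfolding Q_def n_def by blast
  have Q: "cmod (Q (cis (2 * t))) \<le> 1" for t
  proof -
    have "(1 + \<i> * y k) / 2 + (1 - \<i> * y k) / 2 * cis (2 * t) = cis t * of_real (cos t + y k * sin t)" for k
    proof -
      have c: "cis (2 * t) = cis t * cis t" "cis t * cis (- t) = 1" by (simp_all add: cis_mult)
      have "(1 + \<i> * y k) / 2 * cis (- t) + (1 - \<i> * y k) / 2 * cis t = of_real (cos t + y k * sin t)"
        by (simp add: complex_eq_iff field_simps)
      moreover have "(1 + \<i> * y k) / 2 + (1 - \<i> * y k) / 2 * cis (2 * t)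
          = (1 + \<i> * y k) / 2 * (cis t * cis (- t)) + (1 - \<i> * y k) / 2 * (cis t * cis t)"
        by (simp only: c mult_1_right)
      ultimately show ?thesis by (metis distrib_left mult.left_commute)
    qed
    then have "cmod (Q (cis (2 * t))) = \<bar>\<Prod>k\<in>I. cos t + y k * sin t\<bar>"
      by (simp only: Q_def norm_mult norm_of_real norm_cis abs_prod prod_norm[symmetric] mult_1_left)
    with bound show ?thesis by simp
  qed
  have "complex_of_real (n + (\<Sum>k\<in>I. (y k)\<^sup>2) - (\<Sum>k\<in>I. y k)\<^sup>2)
      = (\<Sum>l\<le>n. (\<Sum>j<n. of_real (b j) * cis (2 * pi * real j / real n) ^ l) * q l)"
    unfolding q2[symmetric] by (intro sum.cong refl) (simp add: bs)
  also have "\<dots> = (\<Sum>j<n. of_real (b j) * Q (cis (2 * (pi * real j / real n))))"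
    unfolding q sum_distrib_right sum_distrib_left
    by (subst sum.swap) (simp add: mult_ac)
  finally have "\<bar>n + (\<Sum>k\<in>I. (y k)\<^sup>2) - (\<Sum>k\<in>I. y k)\<^sup>2\<bar>
      = cmod (\<Sum>j<n. of_real (b j) * Q (cis (2 * (pi * real j / real n))))"
    by (metis norm_of_real real_norm_def)
  also have "\<dots> \<le> (\<Sum>j<n. b j)"
  proof (intro sum_norm_le)
    fix j assume "j \<in> {..<n}"
    then have "\<bar>b j\<bar> = b j" using b by simp
    then show "cmod (of_real (b j) * Q (cis (2 * (pi * real j / real n)))) \<le> b j"
      using Q[of "pi * real j / real n"] abs_ge_zero[of "b j"]
      by (metis mult_left_le norm_mult norm_of_real)
  qed
  also have "\<dots> = (real n)\<^sup>2"
  proof -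
    have "complex_of_real (\<Sum>j<n. b j) = of_real ((real n)\<^sup>2)" using bs[of 0] by simp
    then show ?thesis by (simp only: of_real_eq_iff)
  qed
  finally show ?thesis by (simp add: n_def)
qed

lemma sum_eq_0_of_prod_bounded:
  fixes y :: "'a \<Rightarrow> real"
  assumes "\<And>t. \<bar>\<Prod>k\<in>I. cos t + y k * sin t\<bar> \<le> 1"
  shows "(\<Sum>k\<in>I. y k) = 0"
proof (rule DERIV_local_max)
  show "((\<lambda>t. \<Prod>k\<in>I. cos t + y k * sin t) has_real_derivative (\<Sum>k\<in>I. y k)) (at 0)"
    by (rule DERIV_cong, rule has_field_derivative_prod)
       (auto intro!: derivative_eq_intros)
  show "\<forall>t. \<bar>0 - t\<bar> < 1 \<longrightarrow> (\<Prod>k\<in>I. cos t + y k * sin t) \<le> (\<Prod>k\<in>I. cos 0 + y k * sin 0)"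
    using assms by (simp add: abs_le_iff)
qed simp

section \<open>Finite-dimensional spans: projection and compactness\<close>

text \<open>A Gram-Schmidt step: the induction hypothesis, applied to \<open>x\<close> and to the
  new vector \<open>c\<close>, leaves only the component of \<open>x\<close> along \<open>e\<close>,
  the part of \<open>c\<close> orthogonal to \<open>span B\<close>.\<close>

lemma orthogonal_projection_exists:
  fixes B :: "'a::real_inner set"
  assumes "finite B"
  obtains p where "p \<in> span B" "\<And>b. b \<in> span B \<Longrightarrow> (x - p) \<bullet> b = 0"
proof -
  have "\<exists>p\<in>span B. \<forall>b\<in>B. (x - p) \<bullet> b = 0"
    using assms
  proof (induction B arbitrary: x)
    case empty
    then show ?case by simp
  next
    case (insert c B)
    obtain p where p: "p \<in> span B" "\<forall>b\<in>B. (x - p) \<bullet> b = 0"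
      using insert.IH by blast
    obtain r where r: "r \<in> span B" "\<forall>b\<in>B. (c - r) \<bullet> b = 0"
      using insert.IH by blast
    define e where "e = c - r"
    define s where "s = (x - p) \<bullet> e / (e \<bullet> e)"
    have perp: "u \<bullet> b = 0" if "\<forall>b\<in>B. u \<bullet> b = 0" "b \<in> span B" for u b
      using that orthogonal_to_span[of b B u] by (auto simp: orthogonal_def)
    have sub: "span B \<subseteq> span (insert c B)" by (rule span_mono) auto
    have "e \<in> span (insert c B)"
      unfolding e_def using r sub by (intro span_diff) (auto intro: span_base)
    then have "p + s *\<^sub>R e \<in> span (insert c B)"
      using p sub by (intro span_add span_scale) auto
    moreover have "(x - (p + s *\<^sub>R e)) \<bullet> b = 0" if "b \<in> B" for b
      using p r that by (simp add: e_def algebra_simps inner_simps)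
    moreover have "(x - (p + s *\<^sub>R e)) \<bullet> c = 0"
    proof -
      have "(x - (p + s *\<^sub>R e)) \<bullet> e = 0"
        by (cases "e = 0") (simp_all add: s_def inner_simps)
      moreover have "(x - (p + s *\<^sub>R e)) \<bullet> r = 0"
        by (rule perp[OF _ r(1)]) (use \<open>\<And>b. b \<in> B \<Longrightarrow> _\<close> in blast)
      ultimately show ?thesis by (simp add: e_def inner_diff_right)
    qed
    ultimately show ?case by blast
  qed
  then show ?thesis
    using that orthogonal_to_span[of _ B] by (metis orthogonal_def)
qed

text \<open>The ambient space may have infinite dimension, so compactness is built up one direction
  at a time, adding a segment to a compact set. Asking only for a compact superset of the unit ball
  makes such a sum good enough.\<close>

lemma span_finite_unit_ball_compact:
  fixes B :: "'a::real_inner set"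
  assumes "finite B"
  shows "\<exists>K. compact K \<and> K \<subseteq> span B \<and> (\<forall>x\<in>span B. norm x \<le> 1 \<longrightarrow> x \<in> K)"
  using assms
proof induction
  case empty
  show ?case by (rule exI[of _ "{0}"]) simp
next
  case (insert c B)
  obtain K where K: "compact K" "K \<subseteq> span B" "\<And>x. x \<in> span B \<Longrightarrow> norm x \<le> 1 \<Longrightarrow> x \<in> K"
    using insert.IH by blast
  obtain r where r: "r \<in> span B" "\<And>b. b \<in> span B \<Longrightarrow> (c - r) \<bullet> b = 0"
    using orthogonal_projection_exists[OF insert.hyps(1)] by blast
  \<comment> \<open>A unit vector orthogonal to \<open>span B\<close>, or \<open>0\<close> if
    \<open>c\<close> already lies in that span.\<close>
  define e where "e = sgn (c - r)"
  have e: "e \<bullet> b = 0" if "b \<in> span B" for b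
    using r(2)[OF that] by (simp add: e_def sgn_div_norm)
  define L where "L = (\<lambda>t. t *\<^sub>R e) ` {-1..1}"
  have L: "compact L" unfolding L_def by (intro compact_continuous_image continuous_intros) simp
  have sub: "span B \<subseteq> span (insert c B)" by (rule span_mono) auto
  have "e \<in> span (insert c B)"
    unfolding e_def sgn_div_norm using r sub by (intro span_scale span_diff) (auto intro: span_base)
  then have LS: "L \<subseteq> span (insert c B)" by (auto simp: L_def intro: span_scale)
  show ?case
  proof (intro exI[of _ "{u + w |u w. u \<in> K \<and> w \<in> L}"] conjI ballI impI)
    show "compact {u + w |u w. u \<in> K \<and> w \<in> L}" using K(1) L by (rule compact_sums)
    show "{u + w |u w. u \<in> K \<and> w \<in> L} \<subseteq> span (insert c B)"
      using K(2) sub LS by (auto intro!: span_add)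
    fix x assume x: "x \<in> span (insert c B)" and nx: "norm x \<le> 1"
    obtain k where k: "x - k *\<^sub>R c \<in> span B" using x by (auto simp: span_breakdown_eq)
    \<comment> \<open>Moving \<open>k *\<^sub>R r\<close> into the first summand makes the splitting
      of \<open>x\<close> orthogonal, so Pythagoras bounds both parts by \<open>1\<close>.\<close>
    define u where "u = (x - k *\<^sub>R c) + k *\<^sub>R r"
    define t where "t = k * norm (c - r)"
    have u: "u \<in> span B" unfolding u_def using k r by (intro span_add span_scale)
    have te: "t *\<^sub>R e = k *\<^sub>R (c - r)" by (cases "c = r") (simp_all add: t_def e_def sgn_div_norm)
    have xu: "x = u + t *\<^sub>R e" unfolding te by (simp add: u_def algebra_simps)
    have "(norm x)\<^sup>2 = (norm u)\<^sup>2 + (norm (t *\<^sub>R e))\<^sup>2"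
      unfolding xu using e[OF u] by (intro norm_add_Pythagorean) (simp add: orthogonal_def inner_commute)
    moreover have "(norm x)\<^sup>2 \<le> 1" using nx by (simp add: power_le_one_iff)
    ultimately have "(norm u)\<^sup>2 \<le> 1" "(norm (t *\<^sub>R e))\<^sup>2 \<le> 1"
      using zero_le_power2[of "norm u"] zero_le_power2[of "norm (t *\<^sub>R e)"] by linarith+
    then have nu: "norm u \<le> 1" and nt: "norm (t *\<^sub>R e) \<le> 1"
      by (simp_all only: power_le_one_iff abs_square_le_1 abs_norm_cancel)
    have "t *\<^sub>R e \<in> L"
    proof (cases "c = r")
      case True
      then show ?thesis unfolding L_def by (auto simp: e_def intro!: image_eqI[of _ _ 0])
    next
      case False
      then have "norm e = 1" by (simp add: e_def norm_sgn)
      with nt show ?thesis unfolding L_def by (intro imageI) (simp add: abs_le_iff)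
    qed
    then show "x \<in> {u + w |u w. u \<in> K \<and> w \<in> L}"
      using K(3)[OF u nu] xu by blast
  qed
qed

section \<open>The maximizer of the product and its Bessel bound\<close>

text \<open>Finitely many hyperplanes do not cover the span: when \<open>v\<close> moves along
  \<open>w i\<close>, each \<open>k\<close> rules out at most one parameter
  \<open>t\<close>.\<close>

lemma exists_nonorthogonal:
  fixes w :: "'i \<Rightarrow> 'a::real_inner"
  assumes "finite I" "\<And>k. k \<in> I \<Longrightarrow> w k \<noteq> 0"
  shows "\<exists>v\<in>span (w ` I). \<forall>k\<in>I. v \<bullet> w k \<noteq> 0"
  using assms
proof induction
  case empty
  show ?case by (auto intro: span_zero)
next
  case (insert i I)
  then obtain v where v: "v \<in> span (w ` I)" "\<forall>k\<in>I. v \<bullet> w k \<noteq> 0" by auto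
  have "finite ((\<lambda>k. - (v \<bullet> w k) / (w i \<bullet> w k)) ` insert i I \<union> {0})"
    using insert by simp
  then obtain t where t: "t \<notin> (\<lambda>k. - (v \<bullet> w k) / (w i \<bullet> w k)) ` insert i I \<union> {0}"
    using ex_new_if_finite[OF infinite_UNIV_char_0] by blast
  have "(v + t *\<^sub>R w i) \<bullet> w k \<noteq> 0" if k: "k \<in> insert i I" for k
  proof (cases "w i \<bullet> w k = 0")
    case True
    then have "k \<noteq> i" using insert.prems[of i] by auto
    then show ?thesis using True v(2) k by (simp add: inner_simps)
  next
    case False
    have "t \<noteq> - (v \<bullet> w k) / (w i \<bullet> w k)" using t k by auto
    with False show ?thesis by (simp add: inner_simps field_simps)
  qed
  moreover have "v + t *\<^sub>R w i \<in> span (w ` insert i I)"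
    using v(1) span_mono[of "w ` I" "w ` insert i I"]
    by (intro span_add span_scale) (auto intro: span_base)
  ultimately show ?case by blast
qed

lemma product_maximizer:
  fixes w :: "'i \<Rightarrow> 'a::real_inner"
  assumes fin: "finite I" and ne: "I \<noteq> {}" and nz: "\<And>k. k \<in> I \<Longrightarrow> w k \<noteq> 0"
  obtains v where "v \<in> span (w ` I)" "norm v = 1" "\<And>k. k \<in> I \<Longrightarrow> v \<bullet> w k \<noteq> 0"
    "\<And>u. u \<in> span (w ` I) \<Longrightarrow> norm u = 1 \<Longrightarrow> \<bar>\<Prod>k\<in>I. u \<bullet> w k\<bar> \<le> \<bar>\<Prod>k\<in>I. v \<bullet> w k\<bar>"
proof -
  obtain K where K: "compact K" "K \<subseteq> span (w ` I)" "\<And>x. x \<in> span (w ` I) \<Longrightarrow> norm x \<le> 1 \<Longrightarrow> x \<in> K"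
    using span_finite_unit_ball_compact[of "w ` I"] fin by blast
  obtain u0 where u0: "u0 \<in> span (w ` I)" "\<And>k. k \<in> I \<Longrightarrow> u0 \<bullet> w k \<noteq> 0"
    using exists_nonorthogonal[of I w] fin nz by blast
  have "u0 \<noteq> 0" using u0(2) ne by auto
  define u1 where "u1 = u0 /\<^sub>R norm u0"
  have u1: "u1 \<in> span (w ` I)" "norm u1 = 1" "\<And>k. k \<in> I \<Longrightarrow> u1 \<bullet> w k \<noteq> 0"
    using u0 \<open>u0 \<noteq> 0\<close> by (auto simp: u1_def intro: span_scale)
  define S where "S = K \<inter> sphere 0 1"
  have S: "compact S" unfolding S_def using K(1) 
    by (intro compact_Int_closed) (auto simp: sphere_def intro!: closed_Collect_eq continuous_intros)
  have memS: "x \<in> S \<longleftrightarrow> x \<in> span (w ` I) \<and> norm x = 1" for x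
    using K by (auto simp: S_def)
  have "S \<noteq> {}" using u1 memS by auto
  moreover have "continuous_on S (\<lambda>u. \<bar>\<Prod>k\<in>I. u \<bullet> w k\<bar>)"
    by (intro continuous_intros)
  ultimately obtain v where v: "v \<in> S" "\<And>u. u \<in> S \<Longrightarrow> \<bar>\<Prod>k\<in>I. u \<bullet> w k\<bar> \<le> \<bar>\<Prod>k\<in>I. v \<bullet> w k\<bar>"
    using continuous_attains_sup[OF S, of "\<lambda>u. \<bar>\<Prod>k\<in>I. u \<bullet> w k\<bar>"]
    by blast
  \<comment> \<open>A positive value somewhere on the sphere makes the maximum positive, so no
    factor vanishes at \<open>v\<close>.\<close>
  have "\<bar>\<Prod>k\<in>I. u1 \<bullet> w k\<bar> > 0" using u1 fin by simp
  then have "(\<Prod>k\<in>I. v \<bullet> w k) \<noteq> 0" using v(2)[of u1] u1 memS by fastforce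
  then show ?thesis using that v memS fin by auto
qed

lemma norm_sum_le_maximizer:
  fixes w :: "'i \<Rightarrow> 'a::real_inner"
  assumes card: "card I \<ge> 2" and nz: "\<And>k. k \<in> I \<Longrightarrow> w k \<noteq> 0"
  shows "\<exists>v. norm v = 1 \<and> (\<forall>x. (norm (\<Sum>k\<in>I. x k *\<^sub>R w k))\<^sup>2
    \<le> real (card I) * (real (card I) - 1) * (\<Sum>k\<in>I. (x k)\<^sup>2 * (v \<bullet> w k)\<^sup>2))"
proof -
  define n where "n = real (card I)"
  define V where "V = span (w ` I)"
  have n: "n \<ge> 2" using card by (simp add: n_def)
  have ne: "I \<noteq> {}" using card by auto
  have fin: "finite I" using card by (auto intro: card_ge_0_finite)
  obtain v where v: "v \<in> V" "norm v = 1" and vw: "\<And>k. k \<in> I \<Longrightarrow> v \<bullet> w k \<noteq> 0"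
    and vmax: "\<And>u. u \<in> V \<Longrightarrow> norm u = 1 \<Longrightarrow> \<bar>\<Prod>k\<in>I. u \<bullet> w k\<bar> \<le> \<bar>\<Prod>k\<in>I. v \<bullet> w k\<bar>"
    using product_maximizer[of I w] fin ne nz unfolding V_def by blast
  have vv: "v \<bullet> v = 1" using v by (simp add: norm_eq_1)
  \<comment> \<open>The inner product of \<open>s\<close> with the rescaled vector
    \<open>w k / (v \<bullet> w k)\<close>; it is linear in \<open>s\<close> and equals
    \<open>1\<close> at \<open>s = v\<close>.\<close>
  define d where "d s k = (s \<bullet> w k) / (v \<bullet> w k)" for s k
  have unit: "(\<Sum>k\<in>I. d u k) = 0 \<and> (\<Sum>k\<in>I. (d u k)\<^sup>2) \<le> n * (n - 1)"
    if u: "u \<in> V" "u \<bullet> v = 0" "norm u = 1" for u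
  proof -
    have bound: "\<bar>\<Prod>k\<in>I. cos t + d u k * sin t\<bar> \<le> 1" for t
    proof -
      let ?p = "cos t *\<^sub>R v + sin t *\<^sub>R u"
      have "?p \<bullet> ?p = 1"
        using u vv by (simp add: inner_simps inner_commute norm_eq_1 flip: power2_eq_square)
      then have "norm ?p = 1" by (simp add: norm_eq_1)
      moreover have "?p \<in> V" unfolding V_def using u v by (intro span_add span_scale) (auto simp: V_def)
      ultimately have "\<bar>\<Prod>k\<in>I. ?p \<bullet> w k\<bar> \<le> \<bar>\<Prod>k\<in>I. v \<bullet> w k\<bar>" by (rule vmax[rotated])
      also have "(\<Prod>k\<in>I. ?p \<bullet> w k) = (\<Prod>k\<in>I. v \<bullet> w k) * (\<Prod>k\<in>I. cos t + d u k * sin t)"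
        unfolding prod.distrib[symmetric]
        by (intro prod.cong refl) (use vw in \<open>simp add: d_def inner_simps field_simps\<close>)
      finally show ?thesis using vw fin by (simp add: abs_mult mult_le_cancel_left1)
    qed
    have "(\<Sum>k\<in>I. d u k) = 0" by (rule sum_eq_0_of_prod_bounded[OF bound])
    with sum_squares_le_of_prod_bounded[OF fin ne bound] show ?thesis
      by (simp add: n_def power2_eq_square algebra_simps)
  qed
  have perp: "(\<Sum>k\<in>I. d r k) = 0 \<and> (\<Sum>k\<in>I. (d r k)\<^sup>2) \<le> n * (n - 1) * (norm r)\<^sup>2"
    if r: "r \<in> V" "r \<bullet> v = 0" for r
  proof (cases "r = 0")
    case True
    then show ?thesis by (simp add: d_def)
  next
    case False
    define u where "u = r /\<^sub>R norm r"
    have u: "u \<in> V" "u \<bullet> v = 0" "norm u = 1"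
      using r False by (auto simp: u_def V_def intro: span_scale)
    have d: "d r k = norm r * d u k" for k using False by (simp add: d_def u_def)
    have "(norm r)\<^sup>2 * (\<Sum>k\<in>I. (d u k)\<^sup>2) \<le> (norm r)\<^sup>2 * (n * (n - 1))"
      using unit[OF u] by (intro mult_left_mono) auto
    with unit[OF u] show ?thesis
      by (simp add: d power_mult_distrib mult_ac flip: sum_distrib_left)
  qed
  \<comment> \<open>The direction of \<open>v\<close> contributes exactly
    \<open>n * \<alpha>^2\<close>, which fits under the bound because \<open>n \<ge> 2\<close>. The
    cross term vanishes since the \<open>d r k\<close> add up to \<open>0\<close>.\<close>
  have ge: "n * (n - 1) \<ge> n" using n mult_left_mono[of 1 "n - 1" n] by simp
  have main: "(\<Sum>k\<in>I. (d s k)\<^sup>2) \<le> n * (n - 1) * (norm s)\<^sup>2" if s: "s \<in> V" for s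
  proof -
    define \<alpha> where "\<alpha> = s \<bullet> v"
    define r where "r = s - \<alpha> *\<^sub>R v"
    have r: "r \<in> V" "r \<bullet> v = 0"
      using s v vv by (auto simp: r_def \<alpha>_def V_def inner_simps intro: span_diff span_scale)
    have ds: "d s k = \<alpha> + d r k" if "k \<in> I" for k
      using vw[OF that] by (simp add: d_def r_def inner_simps field_simps)
    have "(\<Sum>k\<in>I. (d s k)\<^sup>2) = (\<Sum>k\<in>I. \<alpha>\<^sup>2 + 2 * \<alpha> * d r k + (d r k)\<^sup>2)"
      by (intro sum.cong refl) (simp add: ds power2_sum)
    also have "\<dots> = n * \<alpha>\<^sup>2 + 2 * \<alpha> * (\<Sum>k\<in>I. d r k) + (\<Sum>k\<in>I. (d r k)\<^sup>2)"
      by (simp add: sum.distrib sum_distrib_left n_def)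
    also have "\<dots> \<le> n * (n - 1) * \<alpha>\<^sup>2 + n * (n - 1) * (norm r)\<^sup>2"
      using perp[OF r] mult_right_mono[OF ge, of "\<alpha>\<^sup>2"] by simp
    also have "\<dots> = n * (n - 1) * (norm s)\<^sup>2"
    proof -
      have "s \<bullet> s = \<alpha>\<^sup>2 + r \<bullet> r"
        using vv by (simp add: r_def \<alpha>_def inner_simps inner_commute power2_eq_square)
      then show ?thesis by (simp add: power2_norm_eq_inner algebra_simps)
    qed
    finally show ?thesis .
  qed
  have "(norm (\<Sum>k\<in>I. x k *\<^sub>R w k))\<^sup>2 \<le> n * (n - 1) * (\<Sum>k\<in>I. (x k)\<^sup>2 * (v \<bullet> w k)\<^sup>2)" for x
  proof -
    define s where "s = (\<Sum>k\<in>I. x k *\<^sub>R w k)"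
    define X where "X = (\<Sum>k\<in>I. (x k)\<^sup>2 * (v \<bullet> w k)\<^sup>2)"
    have X: "X \<ge> 0" unfolding X_def by (intro sum_nonneg) simp
    have s: "s \<in> V" unfolding s_def V_def by (intro span_sum span_scale span_base) auto
    \<comment> \<open>Duality: pairing \<open>s\<close> with its own expansion lets Cauchy-Schwarz
      and the Bessel bound \<open>main\<close> apply; one factor \<open>(norm s)^2\<close> then
      cancels.\<close>
    have "(norm s)\<^sup>2 = (\<Sum>k\<in>I. x k * (s \<bullet> w k))"
      unfolding power2_norm_eq_inner by (subst (2) s_def) (simp add: inner_sum_right)
    also have "\<dots> = (\<Sum>k\<in>I. (x k * (v \<bullet> w k)) * d s k)"
      by (intro sum.cong refl) (use vw in \<open>simp add: d_def\<close>)
    finally have "((norm s)\<^sup>2)\<^sup>2 \<le> X * (\<Sum>k\<in>I. (d s k)\<^sup>2)"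
      using Cauchy_Schwarz_ineq_sum[of "\<lambda>k. x k * (v \<bullet> w k)" "d s" I]
      by (simp add: X_def power_mult_distrib)
    also have "\<dots> \<le> X * (n * (n - 1) * (norm s)\<^sup>2)"
      by (intro mult_left_mono main s X)
    finally have "(norm s)\<^sup>2 * (norm s)\<^sup>2 \<le> (n * (n - 1) * X) * (norm s)\<^sup>2"
      by (simp add: power2_eq_square mult_ac)
    then have "(norm s)\<^sup>2 \<le> n * (n - 1) * X"
      using X n mult_right_le_imp_le[of "(norm s)\<^sup>2" "(norm s)\<^sup>2"] by (cases "s = 0") simp_all
    then show ?thesis by (simp add: s_def X_def)
  qed
  with v(2) show ?thesis unfolding n_def by blast
qed

theorem theorem1p4:
  fixes n :: nat and w :: "nat \<Rightarrow> 'h::{real_inner, complete_space}"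
  assumes "n \<ge> 2"
    and "(UNIV :: 'h set) \<noteq> {0}"
  shows "\<exists>v::'h. norm v = 1 \<and>
           (\<forall>x::nat \<Rightarrow> real.
              (norm (\<Sum>k=1..n. x k *\<^sub>R w k))\<^sup>2
                \<le> real n * (real n - 1) * (\<Sum>k=1..n. (x k)\<^sup>2 * \<bar>v \<bullet> w k\<bar>\<^sup>2))"
proof -
  obtain e :: 'h where e: "e \<noteq> 0" using assms(2) by blast
  \<comment> \<open>Zero vectors are replaced rather than dropped, so the index set keeps its
    \<open>n\<close> elements; zero coefficients \<open>x' k\<close> at those places leave both
    sides unchanged.\<close>
  define w' where "w' k = (if w k = 0 then e else w k)" for k
  have "w' k \<noteq> 0" for k using e by (simp add: w'_def)
  then obtain v where v: "norm v = 1"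
    and le: "\<And>x. (norm (\<Sum>k\<in>{1..n}. x k *\<^sub>R w' k))\<^sup>2
      \<le> real n * (real n - 1) * (\<Sum>k\<in>{1..n}. (x k)\<^sup>2 * (v \<bullet> w' k)\<^sup>2)"
    using norm_sum_le_maximizer[of "{1..n}" w'] assms(1) by auto
  have "(norm (\<Sum>k=1..n. x k *\<^sub>R w k))\<^sup>2
      \<le> real n * (real n - 1) * (\<Sum>k=1..n. (x k)\<^sup>2 * \<bar>v \<bullet> w k\<bar>\<^sup>2)" for x
  proof -
    define x' where "x' k = (if w k = 0 then 0 else x k)" for k
    have "(\<Sum>k=1..n. x k *\<^sub>R w k) = (\<Sum>k=1..n. x' k *\<^sub>R w' k)"
      "(\<Sum>k=1..n. (x k)\<^sup>2 * \<bar>v \<bullet> w k\<bar>\<^sup>2) = (\<Sum>k=1..n. (x' k)\<^sup>2 * (v \<bullet> w' k)\<^sup>2)"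
      by (intro sum.cong refl; simp add: x'_def w'_def)+
    with le[of x'] show ?thesis by simp
  qed
  with v show ?thesis by blast
qed

end
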